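(* Let $n_\ell\ge2$ be the number of levels. The error propagator $\mathcal{E}_F^{n_\ell}$ of the multilevel MGRIT V-cycle with F-relaxation is given by $$\mathcal{E}_{F}^{n_\ell}=P_0R_{I_0}-\Big(\prod_{k=0}^{n_\ell-2}P_k\Big)A_{n_\ell-1}^{-1}\Big(\prod_{k=n_\ell-2}^{0}R_k\Big)A_0P_0R_{I_0}-\sum_{i=0}^{n_\ell-3}\Big(\prod_{k=0}^{i}P_k\Big)S_{i+1}(S_{i+1}^TA_{i+1}S_{i+1})^{-1}S_{i+1}^T\Big(\prod_{k=i}^{0}R_k\Big)A_0P_0R_{I_0}.$$
   Context: Fix $n_\ell\ge2$, $N_x\ge1$, coarsening factors $m_0,\dots,m_{n_\ell-2}\ge1$, and $N_0$ such that $N_\ell=(N_{\ell-1}-1)/m_{\ell-1}+1$ are integers $\ge2$ for $\ell=1,\dots,n_\ell-1$. Let $\Phi_\ell\in\mathbb{R}^{N_x\times N_x}$ ($\ell=0,\dots,n_\ell-1$) be time-stepping operators. Vectors on level $\ell$ consist of $N_\ell$ blocks of size $N_x$, indexed $0,\dots,N_\ell-1$. - $A_\ell\in\mathbb{R}^{N_xN_\ell\times N_xN_\ell}$ is block lower bidiagonal with $I$ on the block diagonal and $-\Phi_\ell$ on the first block subdiagonal. - For $\ell\le n_\ell-2$, block indices on level $\ell$ that are multiples of $m_\ell$ are C-points (there are $N_{\ell+1}$ of them); the others are F-points. - Ideal restriction $R_\ell$ ($N_{\ell+1}\times N_\ell$ blocks): block row $0$ has $I$ in block column $0$; block row $j\ge1$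 has $\Phi_\ell^{m_\ell-i}$ in block column $(j-1)m_\ell+i$, $i=1,\dots,m_\ell$; zeros elsewhere. - Ideal interpolation $P_\ell$ ($N_\ell\times N_{\ell+1}$ blocks): block column $j$ has $\Phi_\ell^i$ in block row $jm_\ell+i$ for $0\le i\le m_\ell-1$, $jm_\ell+i\le N_\ell-1$; zeros elsewhere. - $R_{I_\ell}$ ($N_{\ell+1}\times N_\ell$ blocks): block row $j$ has $I$ in block column $jm_\ell$, zeros elsewhere. - $S_\ell$: the block columns of the identity on level $\ell$ that correspond to F-points. Terms $S_\ell(S_\ell^TA_\ell S_\ell)^{-1}S_\ell^T$ are zero if there are no F-points. V-cycle with F-relaxation: on each level $\ell\le n_\ell-2$ one performs F-relaxation, with error propagator $I-S_\ell(S_\ell^TA_\ell S_\ell)^{-1}S_\ell^TA_\ell$ (which equals $P_\ell R_{I_\ell}$), followed by a coarse-grid correction in which $(R_\ell A_\ell P_\ell)^{-1}$ is replaced by the approximate inverse $B_{\ell+1}$ of $A_{\ell+1}$ given by one V-cycle (with zero initial guess) on levels $\ell+1,\dots,n_\ell-1$; the coarsest level is solved exactly. That is, $B_{n_\ell-1}=A_{n_\ell-1}^{-1}$, and for $1\le\ell\le n_\ell-2$, $B_\ell$ is defined by $I-B_\ell A_\ell=(I-P_\ell B_{\ell+1}R_\ell A_\ell)(I-S_\ell(S_\ell^TA_\ell S_\ell)^{-1}S_\ell^TA_\ell)$, and $$\mathcal{E}_F^{n_\ell}=(I-P_0B_1R_0A_0)(I-S_0(S_0^TA_0S_0)^{-1}S_0^TA_0).$$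 Product conventions: $\prod_{k=0}^{i}P_k=P_0P_1\cdots P_i$ and $\prod_{k=i}^{0}R_k=R_iR_{i-1}\cdots R_0$ (ordered products); an empty sum is $0$. *)

theory Defs
  imports "Jordan_Normal_Form.Gauss_Jordan_Elimination"
begin

abbreviation minv :: "real mat \<Rightarrow> real mat" where
  "minv M \<equiv> the (mat_inverse M)"

text \<open>The matrix with \<open>r\<close> by \<open>c\<close> blocks, all of size \<open>Nx\<close> by \<open>Nx\<close>, whose block in
  block row \<open>i\<close> and block column \<open>j\<close> is \<open>f i j\<close>.\<close>

definition block_matrix :: "nat \<Rightarrow> nat \<Rightarrow> nat \<Rightarrow> (nat \<Rightarrow> nat \<Rightarrow> real mat) \<Rightarrow> real mat" where
  "block_matrix Nx r c f =
     mat (r * Nx) (c * Nx) (\<lambda>(i, j). f (i div Nx) (j div Nx) $$ (i mod Nx, j mod Nx))"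

text \<open>Ordered products \<open>X 0 * \<dots> * X i\<close> and \<open>X i * \<dots> * X 0\<close>.\<close>

primrec prod_up :: "(nat \<Rightarrow> real mat) \<Rightarrow> nat \<Rightarrow> real mat" where
  "prod_up X 0 = X 0"
| "prod_up X (Suc i) = prod_up X i * X (Suc i)"

primrec prod_down :: "(nat \<Rightarrow> real mat) \<Rightarrow> nat \<Rightarrow> real mat" where
  "prod_down X 0 = X 0"
| "prod_down X (Suc i) = X (Suc i) * prod_down X i"

text \<open>\<open>X 0 + \<dots> + X (k - 1)\<close> for \<open>d\<close> by \<open>d\<close> matrices; the type of matrices of all dimensions is
  not an additive monoid, so the big operator for sums does not apply to it.\<close>

definition mat_sum :: "nat \<Rightarrow> (nat \<Rightarrow> real mat) \<Rightarrow> nat \<Rightarrow> real mat" where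
  "mat_sum d X k = foldr (\<lambda>i M. X i + M) [0..<k] (0\<^sub>m d d)"

text \<open>\<open>Nx\<close> is the size of a block; level \<open>l\<close> has \<open>N l\<close> blocks, coarsening factor \<open>m l\<close>
  and time-stepping operator \<open>\<Phi> l\<close>.\<close>

context
  fixes Nx :: nat and N m :: "nat \<Rightarrow> nat" and \<Phi> :: "nat \<Rightarrow> real mat"
begin

definition mgrit_A :: "nat \<Rightarrow> real mat" where
  "mgrit_A l = block_matrix Nx (N l) (N l)
     (\<lambda>i j. if i = j then 1\<^sub>m Nx else if i = Suc j then - \<Phi> l else 0\<^sub>m Nx Nx)"

definition ideal_R :: "nat \<Rightarrow> real mat" where
  "ideal_R l = block_matrix Nx (N (Suc l)) (N l)
     (\<lambda>j c. if j = 0 then (if c = 0 then 1\<^sub>m Nx else 0\<^sub>m Nx Nx)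
            else if (j - 1) * m l < c \<and> c \<le> (j - 1) * m l + m l
                 then \<Phi> l ^\<^sub>m (m l - (c - (j - 1) * m l))
            else 0\<^sub>m Nx Nx)"

definition ideal_P :: "nat \<Rightarrow> real mat" where
  "ideal_P l = block_matrix Nx (N l) (N (Suc l))
     (\<lambda>r j. if j * m l \<le> r \<and> r < j * m l + m l then \<Phi> l ^\<^sub>m (r - j * m l) else 0\<^sub>m Nx Nx)"

definition inj_R :: "nat \<Rightarrow> real mat" where
  "inj_R l = block_matrix Nx (N (Suc l)) (N l)
     (\<lambda>j c. if c = j * m l then 1\<^sub>m Nx else 0\<^sub>m Nx Nx)"

definition F_points :: "nat \<Rightarrow> nat list" where
  "F_points l = filter (\<lambda>i. \<not> m l dvd i) [0..<N l]"

definition mgrit_S :: "nat \<Rightarrow> real mat" where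
  "mgrit_S l = block_matrix Nx (N l) (length (F_points l))
     (\<lambda>r c. if r = F_points l ! c then 1\<^sub>m Nx else 0\<^sub>m Nx Nx)"

text \<open>\<open>S (S\<^sup>T A S)\<^sup>-\<^sup>1 S\<^sup>T\<close>, which is zero if there are no F-points.\<close>

definition F_solve :: "nat \<Rightarrow> real mat" where
  "F_solve l =
     (if F_points l = [] then 0\<^sub>m (N l * Nx) (N l * Nx)
      else mgrit_S l * minv (transpose_mat (mgrit_S l) * mgrit_A l * mgrit_S l)
             * transpose_mat (mgrit_S l))"

text \<open>Error propagator on level \<open>l\<close> of F-relaxation followed by a coarse-grid correction that
  uses \<open>B\<close> as approximate coarse-grid inverse.\<close>

definition cycle_error :: "nat \<Rightarrow> real mat \<Rightarrow> real mat" where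
  "cycle_error l B =
     (1\<^sub>m (N l * Nx) - ideal_P l * B * ideal_R l * mgrit_A l) *
     (1\<^sub>m (N l * Nx) - F_solve l * mgrit_A l)"

text \<open>The approximate inverse of \<open>mgrit_A l\<close> given by one V-cycle on the levels
  \<open>l, \<dots>, nl - 1\<close>. On levels finer than the coarsest one it is determined by its error propagator
  \<open>1 - B * mgrit_A l\<close>.\<close>

function vcycle_inv :: "nat \<Rightarrow> nat \<Rightarrow> real mat" where
  "vcycle_inv nl l =
     (if Suc l < nl then
        (THE B. B \<in> carrier_mat (N l * Nx) (N l * Nx) \<and>
           1\<^sub>m (N l * Nx) - B * mgrit_A l = cycle_error l (vcycle_inv nl (Suc l)))
      else minv (mgrit_A l))"
  by pat_completeness auto
termination by (relation "measure (\<lambda>(nl, l). nl - l)") auto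

declare vcycle_inv.simps [simp del]

definition vcycle_error :: "nat \<Rightarrow> real mat" where
  "vcycle_error nl = cycle_error 0 (vcycle_inv nl 1)"

end

end

theory Submission
  imports Defs "Jordan_Normal_Form.Determinant"
begin

text \<open>On each level \<open>A = I - L\<close> is unit lower triangular, hence invertible, and the ideal transfer operators
  satisfy \<open>R A S = 0\<close> and \<open>S\<^sup>T A P = 0\<close>. The second identity gives \<open>I - F A = P R\<^sub>I\<close> for
  \<open>F = S (S\<^sup>T A S)\<^sup>-\<^sup>1 S\<^sup>T\<close>. By the first one the mixed term in the expansion of
  \<open>(I - P B R A) (I - F A)\<close> vanishes, so the approximate inverses satisfy the affine recursion
  \<open>B\<^sub>l = F\<^sub>l + P\<^sub>l B\<^sub>l\<^sub>+\<^sub>1 R\<^sub>l\<close>, which unrolls to the claimed sum.\<close>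

section \<open>Matrix algebra with conditions on dimensions\<close>

text \<open>Premises are equations between dimensions rather than carrier memberships: as
  conditional rewrite rules they leave no sizes to guess, and the dimension simp rules discharge
  them.\<close>

lemma mat_assoc_dim:
  fixes X Y Z :: "real mat"
  assumes "dim_col X = dim_row Y" "dim_col Y = dim_row Z"
  shows "X * Y * Z = X * (Y * Z)"
  using assms by (intro assoc_mult_mat[of _ "dim_row X" "dim_row Y" _ "dim_row Z" _ "dim_col Z"]) auto

lemma mat_diff_mult_dim:
  fixes X Y Z :: "real mat"
  assumes "dim_row X = dim_row Y" "dim_col X = dim_col Y" "dim_col Y = dim_row Z"
  shows "(X - Y) * Z = X * Z - Y * Z"
  by (rule minus_mult_distrib_mat[OF carrier_matI carrier_matI carrier_matI]) (use assms in simp_all)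

lemma mat_mult_diff_dim:
  fixes X Y Z :: "real mat"
  assumes "dim_col X = dim_row Y" "dim_row Y = dim_row Z" "dim_col Y = dim_col Z"
  shows "X * (Y - Z) = X * Y - X * Z"
  by (rule mult_minus_distrib_mat[OF carrier_matI carrier_matI carrier_matI]) (use assms in simp_all)

lemma mat_add_mult_dim:
  fixes X Y Z :: "real mat"
  assumes "dim_row X = dim_row Y" "dim_col X = dim_col Y" "dim_col Y = dim_row Z"
  shows "(X + Y) * Z = X * Z + Y * Z"
  by (rule add_mult_distrib_mat[OF carrier_matI carrier_matI carrier_matI]) (use assms in simp_all)

lemma mat_mult_add_dim:
  fixes X Y Z :: "real mat"
  assumes "dim_col X = dim_row Y" "dim_row Y = dim_row Z" "dim_col Y = dim_col Z"
  shows "X * (Y + Z) = X * Y + X * Z"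
  by (rule mult_add_distrib_mat[OF carrier_matI carrier_matI carrier_matI]) (use assms in simp_all)

lemmas mat_distribs = mat_diff_mult_dim mat_mult_diff_dim mat_add_mult_dim mat_mult_add_dim

lemma mat_neutral_dim:
  fixes X :: "real mat"
  shows "dim_row X = n \<Longrightarrow> 1\<^sub>m n * X = X" "dim_col X = n \<Longrightarrow> X * 1\<^sub>m n = X"
    "dim_row X = n \<Longrightarrow> 0\<^sub>m k n * X = 0\<^sub>m k (dim_col X)"
    "dim_col X = n \<Longrightarrow> X * 0\<^sub>m n k = 0\<^sub>m (dim_row X) k"
    "dim_row X = n \<Longrightarrow> dim_col X = k \<Longrightarrow> X - 0\<^sub>m n k = X"
    "dim_row X = n \<Longrightarrow> dim_col X = k \<Longrightarrow> X - X = 0\<^sub>m n k"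
       apply (rule left_mult_one_mat[OF carrier_matI]; simp)
      apply (rule right_mult_one_mat[OF carrier_matI]; simp)
     apply (rule left_mult_zero_mat[OF carrier_matI]; simp)
    apply (rule right_mult_zero_mat[OF carrier_matI]; simp)
   apply (rule eq_matI; simp)
  apply (rule eq_matI; simp)
  done

text \<open>Multiplicativity of the determinant makes \<open>det X\<close> nonzero, so the
  Gauss-Jordan inversion succeeds and \<open>the\<close> in \<open>minv\<close> has a genuine value.
  A one-sided witness is therefore enough.\<close>

lemma minv_right_inverse:
  assumes X: "X \<in> carrier_mat n n" and Y: "Y \<in> carrier_mat n n" and XY: "X * Y = 1\<^sub>m n"
  shows "minv X \<in> carrier_mat n n" "minv X * X = 1\<^sub>m n" "X * minv X = 1\<^sub>m n"
proof -
  have "det X * det Y = 1"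
    using det_mult[OF X Y] XY by simp
  then have "det X \<noteq> 0" by auto
  then have "X \<in> Units (ring_mat TYPE(real) n ())"
    by (rule det_non_zero_imp_unit[OF X])
  then obtain Z where Z: "mat_inverse X = Some Z"
    using mat_inverse(1)[OF X, of "()"] by (cases "mat_inverse X") auto
  show "minv X \<in> carrier_mat n n" "minv X * X = 1\<^sub>m n" "X * minv X = 1\<^sub>m n"
    using mat_inverse(2)[OF X Z] Z by auto
qed

section \<open>Block matrices\<close>

lemma block_matrix_dim [simp]:
  "dim_row (block_matrix n r c f) = r * n" "dim_col (block_matrix n r c f) = c * n"
  by (auto simp: block_matrix_def)

lemma block_index:
  assumes "i < r * n" "j < c * n"
  shows "block_matrix n r c f $$ (i, j) = f (i div n) (j div n) $$ (i mod n, j mod n)"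
  using assms by (simp add: block_matrix_def)

lemma block_bounds:
  assumes "i < r * (n::nat)"
  shows "i div n < r" "i mod n < n"
proof -
  have "n > 0" using assms by (cases n) auto
  then show "i div n < r" "i mod n < n"
    using assms by (auto simp: less_mult_imp_div_less)
qed

lemma block_matrix_eqI:
  assumes "\<And>i j. i < r \<Longrightarrow> j < c \<Longrightarrow> f i j = g i j"
  shows "block_matrix n r c f = block_matrix n r c g"
  by (rule eq_matI) (auto simp: block_index block_bounds assms)

lemma div_mod_eqI: "i div n = j div n \<Longrightarrow> i mod n = j mod n \<Longrightarrow> i = j" for n :: nat
  by (metis div_mult_mod_eq)

lemma block_matrix_one:
  "block_matrix n r r (\<lambda>i j. if i = j then 1\<^sub>m n else 0\<^sub>m n n) = 1\<^sub>m (r * n)"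
proof (rule eq_matI)
  fix i j assume "i < dim_row (1\<^sub>m (r * n) :: real mat)" "j < dim_col (1\<^sub>m (r * n) :: real mat)"
  then have ij: "i < r * n" "j < r * n" by auto
  have "i = j \<longleftrightarrow> i div n = j div n \<and> i mod n = j mod n"
    by (auto intro: div_mod_eqI)
  then show "block_matrix n r r (\<lambda>i j. if i = j then 1\<^sub>m n else 0\<^sub>m n n) $$ (i, j) = 1\<^sub>m (r * n) $$ (i, j)"
    using ij block_bounds[OF ij(1)] block_bounds[OF ij(2)] by (auto simp: block_index)
qed auto

lemma block_matrix_zero: "block_matrix n r c (\<lambda>i j. 0\<^sub>m n n) = 0\<^sub>m (r * n) (c * n)"
  by (rule eq_matI) (auto simp: block_index block_bounds)

lemma block_matrix_diff:
  assumes "\<And>i j. i < r \<Longrightarrow> j < c \<Longrightarrow> f i j \<in> carrier_mat n n"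
    and "\<And>i j. i < r \<Longrightarrow> j < c \<Longrightarrow> g i j \<in> carrier_mat n n"
  shows "block_matrix n r c f - block_matrix n r c g = block_matrix n r c (\<lambda>i j. f i j - g i j)"
proof (rule eq_matI)
  fix i j assume "i < dim_row (block_matrix n r c (\<lambda>i j. f i j - g i j))"
    "j < dim_col (block_matrix n r c (\<lambda>i j. f i j - g i j))"
  then have ij: "i < r * n" "j < c * n" by auto
  show "(block_matrix n r c f - block_matrix n r c g) $$ (i, j) =
      block_matrix n r c (\<lambda>i j. f i j - g i j) $$ (i, j)"
    using ij block_bounds[OF ij(1)] block_bounds[OF ij(2)]
      assms(2)[OF block_bounds(1)[OF ij(1)] block_bounds(1)[OF ij(2)]]
    by (auto simp: block_index)
qed auto

lemma block_matrix_transpose: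
  assumes "\<And>i j. i < r \<Longrightarrow> j < c \<Longrightarrow> f i j \<in> carrier_mat n n"
  shows "transpose_mat (block_matrix n r c f) = block_matrix n c r (\<lambda>i j. transpose_mat (f j i))"
proof (rule eq_matI)
  fix i j assume "i < dim_row (block_matrix n c r (\<lambda>i j. transpose_mat (f j i)))"
    "j < dim_col (block_matrix n c r (\<lambda>i j. transpose_mat (f j i)))"
  then have ij: "i < c * n" "j < r * n" by auto
  show "transpose_mat (block_matrix n r c f) $$ (i, j) =
      block_matrix n c r (\<lambda>i j. transpose_mat (f j i)) $$ (i, j)"
    using ij block_bounds[OF ij(1)] block_bounds[OF ij(2)]
      assms[OF block_bounds(1)[OF ij(2)] block_bounds(1)[OF ij(1)]]
    by (auto simp: block_index)
qed auto

text \<open>The scalar product over \<open>b * n\<close> inner indices splits into \<open>b\<close>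
  runs of length \<open>n\<close>; each run is one entry of a product of two blocks.\<close>

lemma block_mult_index:
  assumes f: "\<And>i k. i < a \<Longrightarrow> k < b \<Longrightarrow> f i k \<in> carrier_mat n n"
    and g: "\<And>k j. k < b \<Longrightarrow> j < c \<Longrightarrow> g k j \<in> carrier_mat n n"
    and i: "i < a * n" and j: "j < c * n"
  shows "(block_matrix n a b f * block_matrix n b c g) $$ (i, j) =
    (\<Sum>k<b. (f (i div n) k * g k (j div n)) $$ (i mod n, j mod n))"
proof -
  let ?h = "\<lambda>k. f (i div n) (k div n) $$ (i mod n, k mod n) * g (k div n) (j div n) $$ (k mod n, j mod n)"
  note I = block_bounds[OF i] and J = block_bounds[OF j]
  have "(block_matrix n a b f * block_matrix n b c g) $$ (i, j) = (\<Sum>k<b * n. ?h k)"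
    using i j by (auto simp: scalar_prod_def block_index atLeast0LessThan intro!: sum.cong)
  also have "\<dots> = (\<Sum>k<b. sum ?h {k * n..<k * n + n})"
    by (rule sum.nat_group[symmetric])
  also have "\<dots> = (\<Sum>k<b. (f (i div n) k * g k (j div n)) $$ (i mod n, j mod n))"
  proof (rule sum.cong[OF refl])
    fix k assume "k \<in> {..<b}"
    then have k: "k < b" by simp
    have "sum ?h {k * n..<k * n + n} = sum (\<lambda>p. ?h (p + k * n)) {0..<n}"
      using sum.shift_bounds_nat_ivl[of ?h 0 "k * n" n] by (simp add: add.commute)
    also have "\<dots> = sum (\<lambda>p. f (i div n) k $$ (i mod n, p) * g k (j div n) $$ (p, j mod n)) {0..<n}"
      by (intro sum.cong) auto
    also have "\<dots> = (f (i div n) k * g k (j div n)) $$ (i mod n, j mod n)"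
      using f[OF I(1) k] g[OF k J(1)] I(2) J(2) by (simp add: scalar_prod_def)
    finally show "sum ?h {k * n..<k * n + n} = (f (i div n) k * g k (j div n)) $$ (i mod n, j mod n)" .
  qed
  finally show ?thesis .
qed

text \<open>For operators this sparse, every block of a product receives at most one nonzero
  contribution. The selector \<open>s i j\<close> names its inner index; a value
  \<open>\<ge> b\<close> encodes that there is none.\<close>

lemma block_mult_single:
  assumes f: "\<And>i k. i < a \<Longrightarrow> k < b \<Longrightarrow> f i k \<in> carrier_mat n n"
    and g: "\<And>k j. k < b \<Longrightarrow> j < c \<Longrightarrow> g k j \<in> carrier_mat n n"
    and z: "\<And>i j k. i < a \<Longrightarrow> j < c \<Longrightarrow> k < b \<Longrightarrow> k \<noteq> s i j \<Longrightarrow> f i k = 0\<^sub>m n n \<or> g k j = 0\<^sub>m n n"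
  shows "block_matrix n a b f * block_matrix n b c g =
    block_matrix n a c (\<lambda>i j. if s i j < b then f i (s i j) * g (s i j) j else 0\<^sub>m n n)"
    (is "_ = block_matrix n a c ?h")
proof (rule eq_matI)
  fix i j assume "i < dim_row (block_matrix n a c ?h)" "j < dim_col (block_matrix n a c ?h)"
  then have ij: "i < a * n" "j < c * n" by auto
  note I = block_bounds[OF ij(1)] and J = block_bounds[OF ij(2)]
  let ?s = "s (i div n) (j div n)"
  let ?t = "\<lambda>k. (f (i div n) k * g k (j div n)) $$ (i mod n, j mod n)"
  have zero: "?t k = 0" if "k < b" "k \<noteq> ?s" for k
  proof -
    have "f (i div n) k * g k (j div n) = 0\<^sub>m n n"
      using z[OF I(1) J(1) that] left_mult_zero_mat[OF g[OF that(1) J(1)]]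
        right_mult_zero_mat[OF f[OF I(1) that(1)]] by auto
    then show ?thesis using I(2) J(2) by simp
  qed
  have "(\<Sum>k<b. ?t k) = (\<Sum>k<b. if k = ?s then ?t ?s else 0)"
    using zero by (intro sum.cong) auto
  also have "\<dots> = ?h (i div n) (j div n) $$ (i mod n, j mod n)"
    using I(2) J(2) by (auto simp: sum.delta)
  finally show "(block_matrix n a b f * block_matrix n b c g) $$ (i, j) = block_matrix n a c ?h $$ (i, j)"
    using block_mult_index[of a b f n c g i j, OF f g ij] ij by (simp add: block_index)
qed auto

section \<open>The operators of one level\<close>

lemma mgrit_dims [simp]:
  "dim_row (mgrit_A Nx N \<Phi> l) = N l * Nx" "dim_col (mgrit_A Nx N \<Phi> l) = N l * Nx"
  "dim_row (ideal_P Nx N m \<Phi> l) = N l * Nx" "dim_col (ideal_P Nx N m \<Phi> l) = N (Suc l) * Nx"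
  "dim_row (ideal_R Nx N m \<Phi> l) = N (Suc l) * Nx" "dim_col (ideal_R Nx N m \<Phi> l) = N l * Nx"
  "dim_row (inj_R Nx N m l) = N (Suc l) * Nx" "dim_col (inj_R Nx N m l) = N l * Nx"
  "dim_row (mgrit_S Nx N m l) = N l * Nx"
  "dim_col (mgrit_S Nx N m l) = length (F_points N m l) * Nx"
  by (auto simp: mgrit_A_def ideal_P_def ideal_R_def inj_R_def mgrit_S_def)

lemma pow_mat_commute:
  fixes X :: "real mat"
  assumes "X \<in> carrier_mat n n"
  shows "X * X ^\<^sub>m k = X ^\<^sub>m k * X"
proof (induction k)
  case (Suc k)
  then show ?case using assms by (simp add: mat_assoc_dim[symmetric])
qed (use assms in auto)

lemma mgrit_A_inverse:
  assumes Phi: "\<Phi> l \<in> carrier_mat Nx Nx"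
  shows "minv (mgrit_A Nx N \<Phi> l) \<in> carrier_mat (N l * Nx) (N l * Nx)"
    "minv (mgrit_A Nx N \<Phi> l) * mgrit_A Nx N \<Phi> l = 1\<^sub>m (N l * Nx)"
    "mgrit_A Nx N \<Phi> l * minv (mgrit_A Nx N \<Phi> l) = 1\<^sub>m (N l * Nx)"
proof -
  let ?A = "mgrit_A Nx N \<Phi> l" and ?n = "N l * Nx"
  have A: "?A \<in> carrier_mat ?n ?n" by (auto simp: carrier_matI)
  have "det ?A = prod_list (diag_mat ?A)"
  proof (rule det_lower_triangular[OF _ A])
    fix i j assume ij: "i < j" "j < ?n"
    then have i: "i < ?n" by simp
    \<comment> \<open>An entry right of the diagonal lies either in a zero block above the block
      diagonal or off the diagonal of an identity block.\<close>
    have le: "i div Nx \<le> j div Nx" using ij by (simp add: div_le_mono)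
    have "i mod Nx \<noteq> j mod Nx" if "i div Nx = j div Nx"
      using that ij(1) div_mod_eqI[of i Nx j] by auto
    then show "?A $$ (i, j) = 0"
      using le block_bounds[OF i] block_bounds[OF ij(2)] i ij(2)
      by (auto simp: mgrit_A_def block_index)
  qed
  also have "\<dots> = 1"
    unfolding prod_list_diag_prod
    by (rule prod.neutral) (auto simp: mgrit_A_def block_index block_bounds)
  finally have "det ?A \<noteq> 0" by simp
  then have "?A \<in> Units (ring_mat TYPE(real) ?n ())"
    by (rule det_non_zero_imp_unit[OF A])
  then obtain Z where "Z \<in> carrier_mat ?n ?n" "?A * Z = 1\<^sub>m ?n"
    by (auto simp: Units_def ring_mat_def)
  from minv_right_inverse[OF A this]
  show "minv ?A \<in> carrier_mat ?n ?n" "minv ?A * ?A = 1\<^sub>m ?n" "?A * minv ?A = 1\<^sub>m ?n" .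
qed

text \<open>One level together with the next coarser one. \<open>N_fine\<close> is the coarsening
  relation with the division cleared; it makes the last fine index \<open>N l - 1\<close> a
  C-point.\<close>

locale mgrit_level =
  fixes Nx :: nat and N m :: "nat \<Rightarrow> nat" and \<Phi> :: "nat \<Rightarrow> real mat" and l :: nat
  assumes Phi: "\<Phi> l \<in> carrier_mat Nx Nx"
    and m_pos: "m l \<ge> 1"
    and N_coarse: "N (Suc l) \<ge> 1"
    and N_fine: "N l = m l * (N (Suc l) - 1) + 1"
begin

abbreviation "A \<equiv> mgrit_A Nx N \<Phi> l"
abbreviation "P \<equiv> ideal_P Nx N m \<Phi> l"
abbreviation "R \<equiv> ideal_R Nx N m \<Phi> l"
abbreviation "R\<^sub>I \<equiv> inj_R Nx N m l"
abbreviation "S \<equiv> mgrit_S Nx N m l"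
abbreviation "F \<equiv> F_points N m l"
abbreviation "sz \<equiv> N l * Nx"

definition A\<^sub>F :: "real mat" where
  "A\<^sub>F = transpose_mat S * A * S"

definition L :: "real mat" where
  "L = block_matrix Nx (N l) (N l) (\<lambda>i j. if i = Suc j then \<Phi> l else 0\<^sub>m Nx Nx)"

lemma L_dim [simp]: "dim_row L = sz" "dim_col L = sz"
  by (auto simp: L_def)

section \<open>Block action of \<open>A\<close> and \<open>S\<close>\<close>

lemma A_eq: "A = 1\<^sub>m sz - L"
  unfolding L_def block_matrix_one[symmetric] mgrit_A_def
  using Phi by (subst block_matrix_diff) (auto intro!: block_matrix_eqI eq_matI)

lemma A_mult_block:
  assumes "\<And>i j. i < N l \<Longrightarrow> j < c \<Longrightarrow> f i j \<in> carrier_mat Nx Nx"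
  shows "A * block_matrix Nx (N l) c f =
    block_matrix Nx (N l) c (\<lambda>i j. if i = 0 then f i j else f i j - \<Phi> l * f (i - 1) j)"
proof -
  have "L * block_matrix Nx (N l) c f =
      block_matrix Nx (N l) c (\<lambda>i j. if i = 0 then 0\<^sub>m Nx Nx else \<Phi> l * f (i - 1) j)"
    unfolding L_def using Phi assms
    \<comment> \<open>In block row 0 truncated subtraction selects index 0, where the block of
      \<open>L\<close> vanishes, so that row of the product is zero.\<close>
    by (subst block_mult_single[where s = "\<lambda>i j. i - 1"])
      (auto intro!: block_matrix_eqI simp: mat_neutral_dim carrier_matD[OF assms])
  then show ?thesis
    using Phi assms unfolding A_eq
    apply (simp add: mat_distribs)
    apply (subst block_matrix_diff)
      apply (auto intro!: block_matrix_eqI intro: mult_carrier_mat less_imp_diff_less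
        simp: mat_neutral_dim carrier_matD[OF assms])
    done
qed

lemma block_mult_A:
  assumes "\<And>i j. i < r \<Longrightarrow> j < N l \<Longrightarrow> f i j \<in> carrier_mat Nx Nx"
  shows "block_matrix Nx r (N l) f * A =
    block_matrix Nx r (N l) (\<lambda>i j. if Suc j < N l then f i j - f i (Suc j) * \<Phi> l else f i j)"
proof -
  have "block_matrix Nx r (N l) f * L =
      block_matrix Nx r (N l) (\<lambda>i j. if Suc j < N l then f i (Suc j) * \<Phi> l else 0\<^sub>m Nx Nx)"
    unfolding L_def using Phi assms
    \<comment> \<open>For the last block column the selector is \<open>N l\<close>, out of range,
      which yields the zero block.\<close>
    by (subst block_mult_single[where s = "\<lambda>i j. Suc j"]) (auto intro!: block_matrix_eqI)
  then show ?thesis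
    using Phi assms unfolding A_eq
    apply (simp add: mat_distribs)
    apply (subst block_matrix_diff)
      apply (auto intro!: block_matrix_eqI intro: mult_carrier_mat
        simp: mat_neutral_dim carrier_matD[OF assms])
    done
qed

lemma F_nth:
  assumes "c < length F"
  shows "F ! c < N l" "\<not> m l dvd F ! c" "F ! c > 0"
  using nth_mem[OF assms] by (auto simp: F_points_def intro: Nat.gr0I)

lemma block_mult_S:
  assumes "\<And>i j. i < r \<Longrightarrow> j < N l \<Longrightarrow> f i j \<in> carrier_mat Nx Nx"
  shows "block_matrix Nx r (N l) f * S = block_matrix Nx r (length F) (\<lambda>i c. f i (F ! c))"
  unfolding mgrit_S_def using assms F_nth
  by (subst block_mult_single[where s = "\<lambda>i j. F ! j"])
      (auto intro!: block_matrix_eqI simp: mat_neutral_dim carrier_matD[OF assms])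

lemma S_transpose:
  "transpose_mat S = block_matrix Nx (length F) (N l) (\<lambda>c r. if r = F ! c then 1\<^sub>m Nx else 0\<^sub>m Nx Nx)"
  unfolding mgrit_S_def by (subst block_matrix_transpose) (auto intro!: block_matrix_eqI)

lemma S_transpose_mult_block:
  assumes "\<And>i j. i < N l \<Longrightarrow> j < c \<Longrightarrow> f i j \<in> carrier_mat Nx Nx"
  shows "transpose_mat S * block_matrix Nx (N l) c f = block_matrix Nx (length F) c (\<lambda>i j. f (F ! i) j)"
  unfolding S_transpose using assms F_nth
  by (subst block_mult_single[where s = "\<lambda>i j. F ! i"])
      (auto intro!: block_matrix_eqI simp: mat_neutral_dim carrier_matD[OF assms])

lemma S_orthonormal: "transpose_mat S * S = 1\<^sub>m (length F * Nx)"
proof -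
  have "distinct F" by (simp add: F_points_def)
  then show ?thesis
    by (subst (2) mgrit_S_def, subst S_transpose_mult_block)
      (auto simp: block_matrix_one[symmetric] nth_eq_iff_index_eq intro!: block_matrix_eqI)
qed

text \<open>Multiplying by \<open>S\<close> after its transpose keeps the F-rows and erases the
  C-rows, hence fixes any matrix whose C-rows are already zero.\<close>

lemma S_projection_block:
  assumes f: "\<And>i j. i < N l \<Longrightarrow> j < c \<Longrightarrow> f i j \<in> carrier_mat Nx Nx"
    and C: "\<And>i j. i < N l \<Longrightarrow> j < c \<Longrightarrow> m l dvd i \<Longrightarrow> f i j = 0\<^sub>m Nx Nx"
  shows "S * (transpose_mat S * block_matrix Nx (N l) c f) = block_matrix Nx (N l) c f"
proof -
  \<comment> \<open>An F-point is sent to its position in the list \<open>F\<close>; a C-point is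
    sent to the out-of-range value \<open>length F\<close>, so that its row becomes zero.\<close>
  define s where "s i = (if m l dvd i then length F else SOME k. k < length F \<and> F ! k = i)" for i
  have s: "s i < length F" "F ! s i = i" if "i < N l" "\<not> m l dvd i" for i
  proof -
    have "\<exists>k. k < length F \<and> F ! k = i"
      using that by (subst in_set_conv_nth[symmetric]) (auto simp: F_points_def)
    from someI_ex[OF this] show "s i < length F" "F ! s i = i"
      unfolding s_def using that by auto
  qed
  have dF: "distinct F" by (simp add: F_points_def)
  have uniq: "k = s i" if "i < N l" "k < length F" "F ! k = i" for i k
    using s[of i] that F_nth[OF that(2)] dF nth_eq_iff_index_eq by metis
  show ?thesis
    apply (subst S_transpose_mult_block[OF f], assumption, assumption)
    apply (subst mgrit_S_def)
    apply (subst block_mult_single[where s = "\<lambda>i j. s i"])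
    using uniq F_nth f apply auto
    apply (rule block_matrix_eqI)
    subgoal for i j
      using s[of i] f[of i j] C[of i j]
      by (cases "m l dvd i") (auto simp: s_def mat_neutral_dim carrier_matD[OF f])
    done
qed

section \<open>Relations between the transfer operators, \<open>A\<close> and the F-points\<close>

lemma div_less_coarse: "c < N l \<Longrightarrow> c div m l < N (Suc l)"
proof -
  assume "c < N l"
  then have "c div m l \<le> (m l * (N (Suc l) - 1)) div m l"
    using N_fine by (intro div_le_mono) simp
  then show ?thesis using m_pos N_coarse by simp
qed

text \<open>Injection reads the C-point values and \<open>P\<close> propagates each of them up to
  the next C-point. Only the coarse index \<open>c div m l\<close> can contribute, and only if
  \<open>c\<close> is a C-point.\<close>

lemma P_mult_R\<^sub>I:
  "P * R\<^sub>I = block_matrix Nx (N l) (N l)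
     (\<lambda>r c. if m l dvd c \<and> c \<le> r \<and> r < c + m l then \<Phi> l ^\<^sub>m (r - c) else 0\<^sub>m Nx Nx)"
proof -
  have "m l dvd c \<longleftrightarrow> c = c div m l * m l" for c
    by (metis dvd_div_mult_self dvd_triv_right)
  then show ?thesis
    unfolding ideal_P_def inj_R_def using Phi div_less_coarse
    by (subst block_mult_single[where s = "\<lambda>r c. c div m l"])
      (auto intro!: block_matrix_eqI simp: mat_neutral_dim)
qed

text \<open>Interpolation reproduces C-point values exactly, so \<open>P * R\<^sub>I\<close> has the
  same C-rows as the identity and the difference lives on F-rows only.\<close>

lemma S_projection_one_minus_PR\<^sub>I:
  "S * (transpose_mat S * (1\<^sub>m sz - P * R\<^sub>I)) = 1\<^sub>m sz - P * R\<^sub>I"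
proof -
  \<comment> \<open>Two C-points less than one coarsening factor apart coincide.\<close>
  have C: "c = r" if dvd: "m l dvd r" "m l dvd c" and le: "c \<le> r" "r < c + m l" for r c
  proof (rule ccontr)
    assume "c \<noteq> r"
    then have "m l \<le> r - c" using dvd le by (intro dvd_imp_le) auto
    then show False using le by linarith
  qed
  show ?thesis
    unfolding P_mult_R\<^sub>I block_matrix_one[symmetric]
    using Phi C m_pos
    apply (subst (1 2) block_matrix_diff)
        apply (auto)[2]
    apply (rule S_projection_block)
     apply (auto simp: mat_neutral_dim)
    done
qed

text \<open>At an F-point, the block of \<open>P\<close> is \<open>\<Phi> l\<close> times the block
  one time step earlier, so the residual of an interpolated vector vanishes there.\<close>

lemma S_A_P: "transpose_mat S * (A * P) = 0\<^sub>m (length F * Nx) (N (Suc l) * Nx)"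
  unfolding ideal_P_def
  apply (subst A_mult_block)
  subgoal using Phi by auto
  apply (subst S_transpose_mult_block)
  subgoal using Phi by (auto intro!: minus_carrier_mat mult_carrier_mat)
  unfolding block_matrix_zero[symmetric]
proof (rule block_matrix_eqI)
  fix i j assume i: "i < length F" and j: "j < N (Suc l)"
  let ?r = "F ! i"
  \<comment> \<open>An F-point starts neither this coarse interval nor the next, so it and its
    predecessor are both inside or both outside the interval.\<close>
  have r: "?r \<noteq> 0" "?r \<noteq> j * m l" "?r \<noteq> j * m l + m l"
    using F_nth(2,3)[OF i] by (auto intro: dvd_add)
  let ?p = "\<lambda>r. if j * m l \<le> r \<and> r < j * m l + m l then \<Phi> l ^\<^sub>m (r - j * m l) else 0\<^sub>m Nx Nx"
  have E: "?p ?r = \<Phi> l * ?p (?r - 1)"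
  proof (cases "j * m l \<le> ?r \<and> ?r < j * m l + m l")
    case True
    \<comment> \<open>Powers unfold with the new factor on the right, while \<open>A\<close> acts
      from the left; \<open>pow_mat_commute\<close> reconciles the two.\<close>
    then have "?r - j * m l = Suc (?r - 1 - j * m l)" using r by auto
    moreover have "j * m l \<le> ?r - 1 \<and> ?r - 1 < j * m l + m l" using r True by auto
    ultimately show ?thesis using True pow_mat_commute[OF Phi] by simp
  next
    case False
    then have "\<not> (j * m l \<le> ?r - 1 \<and> ?r - 1 < j * m l + m l)" using r by auto
    then show ?thesis using False Phi by (auto simp: mat_neutral_dim)
  qed
  have C: "?p ?r \<in> carrier_mat Nx Nx" using Phi by auto
  show "(if ?r = 0 then ?p ?r else ?p ?r - \<Phi> l * ?p (?r - 1)) = 0\<^sub>m Nx Nx"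
    by (simp only: if_not_P[OF r(1)] E[symmetric] minus_r_inv_mat[OF C])
qed

text \<open>Mirror image of \<open>S_A_P\<close>: at an F-column, the block of \<open>R\<close> is
  the block in the next column times \<open>\<Phi> l\<close>.\<close>

lemma R_A_S: "R * A * S = 0\<^sub>m (N (Suc l) * Nx) (length F * Nx)"
  unfolding ideal_R_def
  apply (subst block_mult_A)
  subgoal using Phi by auto
  apply (subst block_mult_S)
  subgoal using Phi by (auto intro!: minus_carrier_mat mult_carrier_mat)
  unfolding block_matrix_zero[symmetric]
proof (rule block_matrix_eqI)
  fix j i assume j: "j < N (Suc l)" and i: "i < length F"
  let ?c = "F ! i"
  define a where "a = (j - 1) * m l"
  let ?p = "\<lambda>c. if j = 0 then if c = 0 then 1\<^sub>m Nx else 0\<^sub>m Nx Nx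
    else if a < c \<and> c \<le> a + m l then \<Phi> l ^\<^sub>m (m l - (c - a)) else 0\<^sub>m Nx Nx"
  \<comment> \<open>The last inequality holds because \<open>N l - 1\<close> is a C-point; it rules
    out the exceptional last column in \<open>block_mult_A\<close>. The others put \<open>?c\<close>
    and its successor on the same side of the window.\<close>
  have r: "?c \<noteq> 0" "?c \<noteq> a" "?c \<noteq> a + m l" "?c \<noteq> N l - 1"
    using F_nth(2,3)[OF i] N_fine by (auto simp: a_def intro: dvd_add)
  then have last: "Suc ?c < N l" using F_nth(1)[OF i] by simp
  have E: "?p ?c = ?p (Suc ?c) * \<Phi> l"
  proof (cases "j \<noteq> 0 \<and> a < ?c \<and> ?c \<le> a + m l")
    case True
    then have "m l - (?c - a) = Suc (m l - (Suc ?c - a))" using r by auto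
    moreover have "a < Suc ?c \<and> Suc ?c \<le> a + m l" using r True by auto
    ultimately show ?thesis using True by simp
  next
    case False
    then have "\<not> (j \<noteq> 0 \<and> a < Suc ?c \<and> Suc ?c \<le> a + m l)" using r by auto
    then show ?thesis using False Phi r by (auto simp: mat_neutral_dim)
  qed
  have C: "?p ?c \<in> carrier_mat Nx Nx" using Phi by auto
  have "(if Suc ?c < N l then ?p ?c - ?p (Suc ?c) * \<Phi> l else ?p ?c) = 0\<^sub>m Nx Nx"
    by (simp only: if_P[OF last] E[symmetric] minus_r_inv_mat[OF C])
  then show "(if Suc ?c < N l
      then (if j = 0 then if ?c = 0 then 1\<^sub>m Nx else 0\<^sub>m Nx Nx
          else if (j - 1) * m l < ?c \<and> ?c \<le> (j - 1) * m l + m l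
               then \<Phi> l ^\<^sub>m (m l - (?c - (j - 1) * m l)) else 0\<^sub>m Nx Nx) -
         (if j = 0 then if Suc ?c = 0 then 1\<^sub>m Nx else 0\<^sub>m Nx Nx
          else if (j - 1) * m l < Suc ?c \<and> Suc ?c \<le> (j - 1) * m l + m l
               then \<Phi> l ^\<^sub>m (m l - (Suc ?c - (j - 1) * m l)) else 0\<^sub>m Nx Nx) * \<Phi> l
      else (if j = 0 then if ?c = 0 then 1\<^sub>m Nx else 0\<^sub>m Nx Nx
          else if (j - 1) * m l < ?c \<and> ?c \<le> (j - 1) * m l + m l
               then \<Phi> l ^\<^sub>m (m l - (?c - (j - 1) * m l)) else 0\<^sub>m Nx Nx)) = 0\<^sub>m Nx Nx"
    unfolding a_def .
qed

section \<open>Inverse of the F-block and the projection of F-relaxation\<close>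

lemma S_A_one_minus_PR\<^sub>I:
  "transpose_mat S * A * (1\<^sub>m sz - P * R\<^sub>I) = transpose_mat S * A"
proof -
  have "transpose_mat S * A * (P * R\<^sub>I) = transpose_mat S * (A * P) * R\<^sub>I"
    by (simp add: mat_assoc_dim)
  then show ?thesis
    by (simp add: mat_distribs S_A_P mat_neutral_dim)
qed

text \<open>The inverse of the F-block is the F-block of \<open>(I - P R\<^sub>I) A\<^sup>-\<^sup>1\<close>.\<close>

lemma A\<^sub>F_inverse:
  "minv A\<^sub>F \<in> carrier_mat (length F * Nx) (length F * Nx)" "minv A\<^sub>F * A\<^sub>F = 1\<^sub>m (length F * Nx)"
proof -
  note Ainv = mgrit_A_inverse[of \<Phi> l Nx N, OF Phi]
  define Z where "Z = transpose_mat S * (1\<^sub>m sz - P * R\<^sub>I) * minv A * S"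
  have dims: "dim_row (minv A) = sz" "dim_col (minv A) = sz" using Ainv(1) by auto
  \<comment> \<open>The inner projection onto F-rows drops out because
    \<open>1\<^sub>m sz - P * R\<^sub>I\<close> has zero C-rows; that factor is then absorbed by
    \<open>S_A_P\<close>, leaving \<open>A\<close> next to its inverse.\<close>
  have "A\<^sub>F * Z = transpose_mat S * A * (S * (transpose_mat S * (1\<^sub>m sz - P * R\<^sub>I))) * minv A * S"
    unfolding Z_def A\<^sub>F_def by (simp add: mat_assoc_dim dims)
  also have "\<dots> = transpose_mat S * A * minv A * S"
    by (simp only: S_projection_one_minus_PR\<^sub>I S_A_one_minus_PR\<^sub>I)
  also have "\<dots> = transpose_mat S * (A * minv A) * S"
    by (simp add: mat_assoc_dim dims)
  also have "\<dots> = 1\<^sub>m (length F * Nx)"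
    by (simp add: Ainv(3) mat_neutral_dim S_orthonormal)
  finally have "A\<^sub>F * Z = 1\<^sub>m (length F * Nx)" .
  moreover have "A\<^sub>F \<in> carrier_mat (length F * Nx) (length F * Nx)"
    "Z \<in> carrier_mat (length F * Nx) (length F * Nx)"
    by (auto simp: Z_def A\<^sub>F_def carrier_matI)
  ultimately show "minv A\<^sub>F \<in> carrier_mat (length F * Nx) (length F * Nx)"
    "minv A\<^sub>F * A\<^sub>F = 1\<^sub>m (length F * Nx)"
    using minv_right_inverse by blast+
qed

lemma A\<^sub>F_inverse_dim [simp]:
  "dim_row (minv A\<^sub>F) = length F * Nx" "dim_col (minv A\<^sub>F) = length F * Nx"
  using A\<^sub>F_inverse(1) by auto

lemma A\<^sub>F_dim: "dim_row A\<^sub>F = length F * Nx" "dim_col A\<^sub>F = length F * Nx"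
  by (simp_all add: A\<^sub>F_def)

lemma F_solve_eq:
  assumes "F \<noteq> []"
  shows "F_solve Nx N m \<Phi> l = S * minv A\<^sub>F * transpose_mat S"
  using assms by (simp add: F_solve_def A\<^sub>F_def)

lemma F_solve_dim [simp]:
  "dim_row (F_solve Nx N m \<Phi> l) = sz" "dim_col (F_solve Nx N m \<Phi> l) = sz"
  by (auto simp: F_solve_def)

text \<open>With \<open>?Y\<close> the F-rows of \<open>1\<^sub>m sz - P * R\<^sub>I\<close>, the
  transpose of \<open>S\<close> times \<open>A\<close> equals \<open>A\<^sub>F * ?Y\<close>.
  Cancelling \<open>A\<^sub>F\<close> leaves \<open>S * ?Y\<close>, which is the right-hand
  side.\<close>

lemma F_solve_mult_A: "F_solve Nx N m \<Phi> l * A = 1\<^sub>m sz - P * R\<^sub>I"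
proof (cases "F = []")
  case True
  have "1\<^sub>m sz - P * R\<^sub>I = S * (transpose_mat S * (1\<^sub>m sz - P * R\<^sub>I))"
    by (rule S_projection_one_minus_PR\<^sub>I[symmetric])
  \<comment> \<open>Without F-points \<open>S\<close> has no columns, so every entry of the product
    is an empty sum.\<close>
  also have "\<dots> = 0\<^sub>m sz sz"
    using True by (intro eq_matI) (auto simp: scalar_prod_def)
  finally show ?thesis using True by (simp add: F_solve_def mat_neutral_dim)
next
  case False
  let ?Y = "transpose_mat S * (1\<^sub>m sz - P * R\<^sub>I)"
  have "transpose_mat S * A = transpose_mat S * A * (S * ?Y)"
    by (simp only: S_projection_one_minus_PR\<^sub>I S_A_one_minus_PR\<^sub>I)
  also have "\<dots> = A\<^sub>F * ?Y" by (simp add: A\<^sub>F_def mat_assoc_dim)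
  finally have SA: "transpose_mat S * A = A\<^sub>F * ?Y" .
  have "F_solve Nx N m \<Phi> l * A = S * (minv A\<^sub>F * (transpose_mat S * A))"
    using False by (simp add: F_solve_eq mat_assoc_dim)
  also have "\<dots> = S * (minv A\<^sub>F * A\<^sub>F * ?Y)"
    unfolding SA by (simp add: mat_assoc_dim A\<^sub>F_dim)
  also have "\<dots> = 1\<^sub>m sz - P * R\<^sub>I"
    by (simp add: A\<^sub>F_inverse(2) mat_neutral_dim S_projection_one_minus_PR\<^sub>I)
  finally show ?thesis .
qed

section \<open>Error propagator of one cycle and the recursion for approximate inverses\<close>

lemma R_A_F_solve: "R * A * F_solve Nx N m \<Phi> l = 0\<^sub>m (N (Suc l) * Nx) sz"
proof (cases "F = []")
  case False
  then have "R * A * F_solve Nx N m \<Phi> l = R * A * S * (minv A\<^sub>F * transpose_mat S)"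
    by (simp add: F_solve_eq mat_assoc_dim)
  then show ?thesis by (simp add: R_A_S mat_neutral_dim)
qed (simp add: F_solve_def mat_neutral_dim)

lemma cycle_error_eq:
  assumes B: "B \<in> carrier_mat (N (Suc l) * Nx) (N (Suc l) * Nx)"
  shows "cycle_error Nx N m \<Phi> l B = 1\<^sub>m sz - (F_solve Nx N m \<Phi> l + P * B * R) * A"
proof -
  let ?F = "F_solve Nx N m \<Phi> l" and ?C = "P * B * R * A"
  have dims: "dim_row B = N (Suc l) * Nx" "dim_col B = N (Suc l) * Nx" using B by auto
  have "?C * (?F * A) = P * B * (R * A * ?F) * A"
    by (simp add: mat_assoc_dim dims)
  then have zero: "?C * (?F * A) = 0\<^sub>m sz sz"
    by (simp add: R_A_F_solve mat_neutral_dim dims)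
  have "cycle_error Nx N m \<Phi> l B = 1\<^sub>m sz - ?C - ?F * A"
    unfolding cycle_error_def
    by (simp add: mat_distribs dims mat_neutral_dim zero)
  also have "\<dots> = 1\<^sub>m sz - (?F * A + ?C)"
    \<comment> \<open>With \<open>index_mult_mat(1)\<close> removed, entries of the products stay
      atomic and only the additive rearrangement is checked.\<close>
    by (intro eq_matI) (auto simp del: index_mult_mat(1))
  also have "\<dots> = 1\<^sub>m sz - (?F + P * B * R) * A"
    by (simp add: mat_distribs dims)
  finally show ?thesis .
qed

text \<open>Unexpanded form for the finest level, where the final formula keeps
  \<open>P * R\<^sub>I\<close> as a right factor.\<close>

lemma cycle_error_F_relaxation:
  "cycle_error Nx N m \<Phi> l B = (1\<^sub>m sz - P * B * R * A) * (P * R\<^sub>I)"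
proof -
  have "1\<^sub>m sz - F_solve Nx N m \<Phi> l * A = P * R\<^sub>I"
    unfolding F_solve_mult_A by (intro eq_matI) (auto simp del: index_mult_mat(1))
  then show ?thesis by (simp add: cycle_error_def)
qed

text \<open>Existence for the definite description comes from \<open>cycle_error_eq\<close>;
  uniqueness holds because \<open>A\<close> is invertible and can be cancelled on the right.\<close>

lemma vcycle_inv_eq:
  assumes "Suc l < nl"
    and B: "vcycle_inv Nx N m \<Phi> nl (Suc l) \<in> carrier_mat (N (Suc l) * Nx) (N (Suc l) * Nx)"
  shows "vcycle_inv Nx N m \<Phi> nl l = F_solve Nx N m \<Phi> l + P * vcycle_inv Nx N m \<Phi> nl (Suc l) * R"
    (is "_ = ?B")
proof -
  note Ainv = mgrit_A_inverse[of \<Phi> l Nx N, OF Phi]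
  have dimA: "dim_row (minv A) = sz" using Ainv(1) by auto
  have Bc: "?B \<in> carrier_mat sz sz" by (auto simp: carrier_matI)
  show ?thesis
    unfolding vcycle_inv.simps[of Nx N m \<Phi> nl l] if_P[OF assms(1)] cycle_error_eq[OF B]
  proof (rule the_equality)
    fix X assume X: "X \<in> carrier_mat sz sz \<and> 1\<^sub>m sz - X * A = 1\<^sub>m sz - ?B * A"
    have dX: "dim_col X = sz" using X by auto
    have "X * A = 1\<^sub>m sz - (1\<^sub>m sz - X * A)"
      using conjunct1[OF X] by (intro eq_matI) (auto simp del: index_mult_mat(1))
    also have "\<dots> = 1\<^sub>m sz - (1\<^sub>m sz - ?B * A)" using X by simp
    also have "\<dots> = ?B * A"
      using Bc by (intro eq_matI) (auto simp del: index_mult_mat(1))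
    finally have "X * A * minv A = ?B * A * minv A" by simp
    then have "X * (A * minv A) = ?B * (A * minv A)"
      using dX Bc dimA by (simp add: mat_assoc_dim)
    then show "X = ?B"
      using dX Bc unfolding Ainv(3) by (simp add: mat_neutral_dim)
  qed (use Bc in auto)
qed

end

section \<open>Unrolling the recursion\<close>

lemma mat_sum_dim:
  assumes "\<And>i. i < k \<Longrightarrow> X i \<in> carrier_mat d d"
  shows "mat_sum d X k \<in> carrier_mat d d"
proof -
  have "foldr (\<lambda>i M. X i + M) is (0\<^sub>m d d) \<in> carrier_mat d d"
    if "\<forall>i\<in>set is. X i \<in> carrier_mat d d" for "is"
    using that by (induction "is") auto
  then show ?thesis using assms by (simp add: mat_sum_def)
qed

text \<open>The fold peels off first summands, whereas a last one is added here. Appending it only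
  changes the start value of the fold, so the induction runs over the list for an arbitrary start
  value \<open>Y\<close>.\<close>

lemma mat_sum_Suc:
  assumes "\<And>i. i \<le> k \<Longrightarrow> X i \<in> carrier_mat d d"
  shows "mat_sum d X (Suc k) = mat_sum d X k + X k"
proof -
  have "foldr (\<lambda>i M. X i + M) is (0\<^sub>m d d) \<in> carrier_mat d d \<and>
      foldr (\<lambda>i M. X i + M) is Y = foldr (\<lambda>i M. X i + M) is (0\<^sub>m d d) + Y"
    if "\<forall>i\<in>set is. X i \<in> carrier_mat d d" "Y \<in> carrier_mat d d" for "is" Y
    using that by (induction "is") auto
  from conjunct2[OF this[of "[0..<k]" "X k"]] show ?thesis
    using assms[of k] assms by (simp add: mat_sum_def)
qed

lemma prod_up_dim:
  assumes "\<And>i. dim_row (X i) = n i" "\<And>i. dim_col (X i) = n (Suc i)"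
  shows "dim_row (prod_up X k) = n 0" "dim_col (prod_up X k) = n (Suc k)"
  by (induction k) (simp_all add: assms)

lemma prod_down_dim:
  assumes "\<And>i. dim_row (X i) = n (Suc i)" "\<And>i. dim_col (X i) = n i"
  shows "dim_row (prod_down X k) = n (Suc k)" "dim_col (prod_down X k) = n 0"
  by (induction k) (simp_all add: assms)

theorem lemma3p2:
  fixes nl Nx :: nat and N m :: "nat \<Rightarrow> nat" and \<Phi> :: "nat \<Rightarrow> real mat"
    and A P R R\<^sub>I :: "nat \<Rightarrow> real mat"
  assumes "nl \<ge> 2" and "Nx \<ge> 1"
    and "\<And>l. l \<le> nl - 2 \<Longrightarrow> m l \<ge> 1"
    and "\<And>l. 1 \<le> l \<Longrightarrow> l \<le> nl - 1 \<Longrightarrow> real (N l) = (real (N (l - 1)) - 1) / real (m (l - 1)) + 1"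
    and "\<And>l. 1 \<le> l \<Longrightarrow> l \<le> nl - 1 \<Longrightarrow> N l \<ge> 2"
    and "\<And>l. l \<le> nl - 1 \<Longrightarrow> \<Phi> l \<in> carrier_mat Nx Nx"
  defines "A \<equiv> mgrit_A Nx N \<Phi>"
    and "P \<equiv> ideal_P Nx N m \<Phi>"
    and "R \<equiv> ideal_R Nx N m \<Phi>"
    and "R\<^sub>I \<equiv> inj_R Nx N m"
  shows "vcycle_error Nx N m \<Phi> nl =
      P 0 * R\<^sub>I 0
      - prod_up P (nl - 2) * minv (A (nl - 1)) * prod_down R (nl - 2) * A 0 * P 0 * R\<^sub>I 0
      - mat_sum (N 0 * Nx)
          (\<lambda>i. prod_up P i * F_solve Nx N m \<Phi> (i + 1) * prod_down R i * A 0 * P 0 * R\<^sub>I 0)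
          (nl - 2)"
proof -
  let ?F = "F_solve Nx N m \<Phi>" and ?sz = "N 0 * Nx"
  define V where "V = vcycle_inv Nx N m \<Phi> nl"
  have level: "mgrit_level Nx N m \<Phi> l" if "l \<le> nl - 2" for l
  proof
    have l: "Suc l \<le> nl - 1" using that assms(1) by simp
    show m: "m l \<ge> 1" using assms(3) that .
    show N: "N (Suc l) \<ge> 1" using assms(5)[of "Suc l"] l by simp
    \<comment> \<open>The real division is cleared first; \<open>N (Suc l) \<ge> 1\<close> then
      makes the truncated subtraction on naturals agree with the real one.\<close>
    have "real (N l) = real (m l) * (real (N (Suc l)) - 1) + 1"
      using assms(4)[of "Suc l"] l m by (simp add: field_simps)
    also have "\<dots> = real (m l * (N (Suc l) - 1) + 1)"
      using N by (simp add: of_nat_diff)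
    finally show "N l = m l * (N (Suc l) - 1) + 1"
      by (simp only: of_nat_eq_iff)
    show "\<Phi> l \<in> carrier_mat Nx Nx" using assms(6) that by simp
  qed
  have V_coarsest: "V (nl - 1) = minv (A (nl - 1))"
    unfolding V_def A_def by (subst vcycle_inv.simps) (use assms(1) in simp)
  have V_carrier: "V l \<in> carrier_mat (N l * Nx) (N l * Nx)" if "l \<le> nl - 1" for l
    using that
  \<comment> \<open>The induction descends from the coarsest level, since the recursion needs the
    size of the next coarser approximate inverse.\<close>
  proof (induction l rule: inc_induct)
    case base
    then show ?case
      unfolding V_coarsest A_def by (rule mgrit_A_inverse(1)[OF assms(6)]) simp
  next
    case (step l)
    interpret mgrit_level Nx N m \<Phi> l using step(2) by (intro level) simp
    show ?case
      using vcycle_inv_eq[OF _ step.IH[unfolded V_def]] step(2)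
      unfolding V_def by (auto simp: carrier_matI)
  qed
  \<comment> \<open>Only levels from 1 on occur: the finest level enters through its error
    propagator, not through an approximate inverse.\<close>
  have V_step: "V (Suc k) = ?F (Suc k) + P (Suc k) * V (Suc (Suc k)) * R (Suc k)" if "k < nl - 2" for k
  proof -
    interpret mgrit_level Nx N m \<Phi> "Suc k" using that by (intro level) simp
    show ?thesis
      unfolding V_def P_def R_def
      by (rule vcycle_inv_eq) (use that V_carrier[of "Suc (Suc k)"] in \<open>auto simp: V_def\<close>)
  qed
  have Fdim: "dim_row (?F l) = N l * Nx" "dim_col (?F l) = N l * Nx" if "l \<le> nl - 2" for l
    using mgrit_level.F_solve_dim[OF level[OF that]] .
  have Vdim: "dim_row (V l) = N l * Nx" "dim_col (V l) = N l * Nx" if "l \<le> nl - 1" for l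
    using V_carrier[OF that] by auto
  have dims: "dim_row (P l) = N l * Nx" "dim_col (P l) = N (Suc l) * Nx"
    "dim_row (R l) = N (Suc l) * Nx" "dim_col (R l) = N l * Nx"
    "dim_row (R\<^sub>I l) = N (Suc l) * Nx" "dim_col (R\<^sub>I l) = N l * Nx"
    "dim_row (A l) = N l * Nx" "dim_col (A l) = N l * Nx" for l
    by (simp_all add: P_def R_def R\<^sub>I_def A_def)
  note pdims = prod_up_dim[of P "\<lambda>i. N i * Nx", OF dims(1,2)]
    prod_down_dim[of R "\<lambda>i. N i * Nx", OF dims(3,4)]
  \<comment> \<open>\<open>T i\<close> is the F-relaxation term of level \<open>i + 1\<close>;
    \<open>E k\<close> is the part not yet unrolled, still containing the approximate inverse of
    level \<open>k + 1\<close>.\<close>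
  define T where "T i = prod_up P i * ?F (i + 1) * prod_down R i * A 0 * P 0 * R\<^sub>I 0" for i
  define E where "E k = prod_up P k * V (Suc k) * prod_down R k * A 0 * P 0 * R\<^sub>I 0" for k
  have T: "T i \<in> carrier_mat ?sz ?sz" for i
    by (rule carrier_matI) (simp_all add: T_def dims pdims)
  have E: "E i \<in> carrier_mat ?sz ?sz" for i
    by (rule carrier_matI) (simp_all add: E_def dims pdims)
  have E_step: "E k = E (Suc k) + T k" if "k < nl - 2" for k
  proof -
    have k: "Suc k \<le> nl - 2" "Suc (Suc k) \<le> nl - 1" using that by auto
    have "E k = T k + E (Suc k)"
      unfolding E_def T_def V_step[OF that]
      by (simp add: mat_distribs mat_assoc_dim dims pdims Fdim[OF k(1)] Vdim[OF k(2)])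
    then show ?thesis using comm_add_mat[OF T E] by simp
  qed
  \<comment> \<open>Invariant of the unrolling: each step moves one F-relaxation term from the
    remainder into the sum.\<close>
  have unrolled: "E 0 = E k + mat_sum ?sz T k" if "k \<le> nl - 2" for k
    using that
  proof (induction k)
    case 0
    then show ?case using E[of 0] by (simp add: mat_sum_def)
  next
    case (Suc k)
    have S: "mat_sum ?sz T k \<in> carrier_mat ?sz ?sz" by (rule mat_sum_dim) (rule T)
    have "E 0 = E (Suc k) + T k + mat_sum ?sz T k"
      using Suc E_step[of k] by simp
    also have "\<dots> = E (Suc k) + (mat_sum ?sz T k + T k)"
      using comm_add_mat[OF T S] assoc_add_mat[OF E T S] by simp
    finally show ?case by (simp add: mat_sum_Suc[OF T])
  qed
  have S: "mat_sum ?sz T (nl - 2) \<in> carrier_mat ?sz ?sz" by (rule mat_sum_dim) (rule T)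
  have PRI: "P 0 * R\<^sub>I 0 \<in> carrier_mat ?sz ?sz" by (rule carrier_matI) (simp_all add: dims)
  have one: "(1::nat) \<le> nl - 1" "Suc 0 \<le> nl - 1" using assms(1) by auto
  have "vcycle_error Nx N m \<Phi> nl = (1\<^sub>m ?sz - P 0 * V 1 * R 0 * A 0) * (P 0 * R\<^sub>I 0)"
    using mgrit_level.cycle_error_F_relaxation[OF level[of 0]]
    unfolding vcycle_error_def V_def P_def R_def A_def R\<^sub>I_def by simp
  also have "\<dots> = P 0 * R\<^sub>I 0 - E 0"
    unfolding E_def by (simp add: mat_distribs mat_assoc_dim mat_neutral_dim dims Vdim[OF one(2)])
  \<comment> \<open>After \<open>nl - 2\<close> steps the remainder contains the coarsest level
    \<open>nl - 1\<close>, where the inverse is exact. For two levels the sum is empty and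
    \<open>E 0\<close> is already the coarse-grid term.\<close>
  also have "\<dots> = P 0 * R\<^sub>I 0 - E (nl - 2) - mat_sum ?sz T (nl - 2)"
    unfolding unrolled[OF order.refl] by (rule minus_add_minus_mat[OF PRI E S])
  also have "E (nl - 2) =
      prod_up P (nl - 2) * minv (A (nl - 1)) * prod_down R (nl - 2) * A 0 * P 0 * R\<^sub>I 0"
  proof -
    have "Suc (nl - 2) = nl - 1" using assms(1) by simp
    then show ?thesis by (simp only: E_def V_coarsest)
  qed
  finally show ?thesis unfolding T_def .
qed

end
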